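(* Let $G$ be a group equipped with the subgroup topology determined by a neighbourhood family $\Sigma$ of subgroups of $G$. If for every $t\in G$ the right translation map $r_t:G\to G$, $r_t(g)=gt$, is continuous, then $G$ is a topological group.
   Context: A neighbourhood family on a group $G$ is a nonempty collection $\Sigma$ of subgroups of $G$ such that for all $H,K\in\Sigma$ there is $S\in\Sigma$ with $S\subseteq H\cap K$. The subgroup topology on $G$ determined by $\Sigma$ is the topology having the collection of all left cosets $gH$ ($g\in G$, $H\in\Sigma$) as a basis. A topological group is a group with a topology for which multiplication $G\times G\to G$ and inversion $G\to G$ are continuous (no separation axiom is assumed). *)

theory Defs
  imports "HOL-Algebra.Left_Coset" "HOL-Analysis.Product_Topology"
begin

definition neighbourhood_family :: "('a, 'b) monoid_scheme \<Rightarrow> 'a set set \<Rightarrow> bool" where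
  "neighbourhood_family G \<Sigma> \<longleftrightarrow>
     \<Sigma> \<noteq> {} \<and> (\<forall>H\<in>\<Sigma>. subgroup H G) \<and>
     (\<forall>H\<in>\<Sigma>. \<forall>K\<in>\<Sigma>. \<exists>S\<in>\<Sigma>. S \<subseteq> H \<inter> K)"

definition left_cosets :: "('a, 'b) monoid_scheme \<Rightarrow> 'a set set \<Rightarrow> 'a set set" where
  "left_cosets G \<Sigma> = {g <#\<^bsub>G\<^esub> H | g H. g \<in> carrier G \<and> H \<in> \<Sigma>}"

text \<open>The open sets are the arbitrary unions of left cosets, i.e. the left cosets form a basis
  (not merely a subbasis). That this is a topology for every neighbourhood family is
  shown in \<open>openin_subgroup_topology\<close> below.\<close>

definition subgroup_topology :: "('a, 'b) monoid_scheme \<Rightarrow> 'a set set \<Rightarrow> 'a topology" where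
  "subgroup_topology G \<Sigma> = topology (arbitrary union_of (\<lambda>U. U \<in> left_cosets G \<Sigma>))"

definition topological_group :: "('a, 'b) monoid_scheme \<Rightarrow> 'a topology \<Rightarrow> bool" where
  "topological_group G T \<longleftrightarrow>
     group G \<and> topspace T = carrier G \<and>
     continuous_map (prod_topology T T) T (\<lambda>(x, y). x \<otimes>\<^bsub>G\<^esub> y) \<and>
     continuous_map T T (\<lambda>x. inv\<^bsub>G\<^esub> x)"

lemma left_coset_eq_of_mem:
  assumes "group G" "subgroup H G" "g \<in> carrier G" "x \<in> g <#\<^bsub>G\<^esub> H"
  shows "x \<in> carrier G" "g <#\<^bsub>G\<^esub> H = x <#\<^bsub>G\<^esub> H"
proof -
  interpret group G by fact
  show "g <#\<^bsub>G\<^esub> H = x <#\<^bsub>G\<^esub> H"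
    using l_repr_independence assms by blast
  show "x \<in> carrier G"
    using assms l_coset_carrier by blast
qed

lemma openin_subgroup_topology:
  assumes G: "group G" and \<Sigma>: "neighbourhood_family G \<Sigma>"
  shows "openin (subgroup_topology G \<Sigma>) = arbitrary union_of (\<lambda>U. U \<in> left_cosets G \<Sigma>)"
proof -
  have "(arbitrary union_of (\<lambda>U. U \<in> left_cosets G \<Sigma>)) (A \<inter> B)"
    if "A \<in> left_cosets G \<Sigma>" "B \<in> left_cosets G \<Sigma>" for A B
  proof -
    obtain a H b K where A: "A = a <#\<^bsub>G\<^esub> H" "a \<in> carrier G" "H \<in> \<Sigma>"
      and B: "B = b <#\<^bsub>G\<^esub> K" "b \<in> carrier G" "K \<in> \<Sigma>"
      using \<open>A \<in> _\<close> \<open>B \<in> _\<close> by (auto simp: left_cosets_def)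
    obtain S where S: "S \<in> \<Sigma>" "S \<subseteq> H \<inter> K"
      using \<Sigma> A B by (meson neighbourhood_family_def)
    have sub: "subgroup H G" "subgroup K G" "subgroup S G"
      using \<Sigma> A B S by (auto simp: neighbourhood_family_def)
    have "\<exists>U\<in>left_cosets G \<Sigma>. x \<in> U \<and> U \<subseteq> A \<inter> B" if "x \<in> A \<inter> B" for x
    proof -
      have x: "x \<in> carrier G" "A = x <#\<^bsub>G\<^esub> H" "B = x <#\<^bsub>G\<^esub> K"
        using that left_coset_eq_of_mem[OF G] A B sub by blast+
      then have "x <#\<^bsub>G\<^esub> S \<subseteq> A \<inter> B"
        using S by (auto simp: l_coset_def)
      then show ?thesis
        using x S group.lcos_self[OF G _ sub(3)] by (auto simp: left_cosets_def)
    qed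
    then show ?thesis
      unfolding arbitrary_union_of_alt by meson
  qed
  then have "istopology (arbitrary union_of (\<lambda>U. U \<in> left_cosets G \<Sigma>))"
    by (simp add: istopology_base_eq)
  then show ?thesis
    by (simp add: subgroup_topology_def topology_inverse')
qed

lemma topspace_subgroup_topology:
  assumes G: "group G" and \<Sigma>: "neighbourhood_family G \<Sigma>"
  shows "topspace (subgroup_topology G \<Sigma>) = carrier G"
proof
  have "\<Union>(left_cosets G \<Sigma>) \<subseteq> carrier G"
    using left_coset_eq_of_mem(1)[OF G] \<Sigma>
    by (fastforce simp: left_cosets_def neighbourhood_family_def)
  then show "topspace (subgroup_topology G \<Sigma>) \<subseteq> carrier G"
    unfolding topspace_def openin_subgroup_topology[OF assms] union_of_def by blast
  show "carrier G \<subseteq> topspace (subgroup_topology G \<Sigma>)"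
  proof
    fix x assume x: "x \<in> carrier G"
    obtain H where H: "H \<in> \<Sigma>" "subgroup H G"
      using \<Sigma> by (auto simp: neighbourhood_family_def)
    then have "openin (subgroup_topology G \<Sigma>) (x <#\<^bsub>G\<^esub> H)"
      unfolding openin_subgroup_topology[OF assms]
      using x by (auto intro!: union_of_inc simp: arbitrary_def left_cosets_def)
    then show "x \<in> topspace (subgroup_topology G \<Sigma>)"
      using group.lcos_self[OF G x H(2)] openin_subset by blast
  qed
qed

end

theory Submission
  imports Defs
begin

text \<open>
  Left translations permute the basic open sets, so near each point \<open>x\<close> the topology looks like
  \<open>\<Sigma>\<close> moved to \<open>x\<close> from the left. What both group operations need besides this is control of
  conjugation: a small subgroup must be able to pass through a fixed element \<open>t\<close>, in the sense
  that \<open>K t \<subseteq> t H\<close> for some \<open>K \<in> \<Sigma>\<close> depending on \<open>t\<close> and \<open>H \<in> \<Sigma>\<close>. This is precisely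
  continuity of \<open>r\<^sub>t\<close> at the identity (\<open>right_translation_conjugates\<close>). Given it,
  \<open>(a K) (b H) = a (K b) H \<subseteq> a b H H = a b H\<close> when \<open>K b \<subseteq> b H\<close>, and
  \<open>(a K)\<^sup>-\<^sup>1 = K a\<^sup>-\<^sup>1 \<subseteq> a\<^sup>-\<^sup>1 H\<close> when \<open>K a\<^sup>-\<^sup>1 \<subseteq> a\<^sup>-\<^sup>1 H\<close>. That members of \<open>\<Sigma>\<close> are closed under
  products and inverses is what makes these computations close up without shrinking \<open>H\<close>.
\<close>

lemma openin_l_coset:
  assumes "group G" "neighbourhood_family G \<Sigma>" "x \<in> carrier G" "H \<in> \<Sigma>"
  shows "openin (subgroup_topology G \<Sigma>) (x <#\<^bsub>G\<^esub> H)"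
  unfolding openin_subgroup_topology[OF assms(1,2)]
  using assms(3,4) by (auto intro!: union_of_inc simp: arbitrary_def left_cosets_def)

text \<open>A coset that contains \<open>x\<close> is itself the coset of \<open>x\<close>, so the cosets of \<open>x\<close> alone form a
  neighbourhood base there.\<close>

lemma openin_subgroup_topology_iff:
  assumes G: "group G" and \<Sigma>: "neighbourhood_family G \<Sigma>"
  shows "openin (subgroup_topology G \<Sigma>) U \<longleftrightarrow>
    U \<subseteq> carrier G \<and> (\<forall>x\<in>U. \<exists>H\<in>\<Sigma>. x <#\<^bsub>G\<^esub> H \<subseteq> U)"
proof (intro iffI conjI ballI)
  assume U: "openin (subgroup_topology G \<Sigma>) U"
  then show "U \<subseteq> carrier G"
    using openin_subset topspace_subgroup_topology[OF assms] by metis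
  fix x assume "x \<in> U"
  then obtain B where B: "B \<in> left_cosets G \<Sigma>" "x \<in> B" "B \<subseteq> U"
    using U unfolding openin_subgroup_topology[OF assms] arbitrary_union_of_alt by blast
  then obtain g H where gH: "g \<in> carrier G" "H \<in> \<Sigma>" "B = g <#\<^bsub>G\<^esub> H"
    by (auto simp: left_cosets_def)
  then have "subgroup H G"
    using \<Sigma> by (simp add: neighbourhood_family_def)
  then have "B = x <#\<^bsub>G\<^esub> H"
    using left_coset_eq_of_mem(2)[OF G] gH B by blast
  with B gH show "\<exists>H\<in>\<Sigma>. x <#\<^bsub>G\<^esub> H \<subseteq> U"
    by blast
next
  assume U: "U \<subseteq> carrier G \<and> (\<forall>x\<in>U. \<exists>H\<in>\<Sigma>. x <#\<^bsub>G\<^esub> H \<subseteq> U)"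
  show "openin (subgroup_topology G \<Sigma>) U"
  proof (subst openin_subopen, intro ballI)
    fix x assume "x \<in> U"
    then obtain H where H: "H \<in> \<Sigma>" "x <#\<^bsub>G\<^esub> H \<subseteq> U" "x \<in> carrier G"
      using U by blast
    moreover have "subgroup H G"
      using \<Sigma> H by (simp add: neighbourhood_family_def)
    ultimately show "\<exists>T. openin (subgroup_topology G \<Sigma>) T \<and> x \<in> T \<and> T \<subseteq> U"
      using openin_l_coset[OF assms, of x H] group.lcos_self[OF G, of x H] by auto
  qed
qed

text \<open>The open set \<open>t H\<close> contains \<open>r\<^sub>t \<one> = t\<close>, so its preimage under \<open>r\<^sub>t\<close> contains a coset of
  the identity, that is, a member of \<open>\<Sigma>\<close>.\<close>

lemma right_translation_conjugates:
  assumes G: "group G" and \<Sigma>: "neighbourhood_family G \<Sigma>"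
    and cont: "continuous_map (subgroup_topology G \<Sigma>) (subgroup_topology G \<Sigma>)
      (\<lambda>g. g \<otimes>\<^bsub>G\<^esub> t)"
    and t: "t \<in> carrier G" and H: "H \<in> \<Sigma>"
  obtains K where "K \<in> \<Sigma>" "\<And>k. k \<in> K \<Longrightarrow> k \<otimes>\<^bsub>G\<^esub> t \<in> t <#\<^bsub>G\<^esub> H"
proof -
  interpret group G by (fact G)
  have "subgroup H G"
    using \<Sigma> H by (simp add: neighbourhood_family_def)
  then have "\<one>\<^bsub>G\<^esub> \<in> {g \<in> carrier G. g \<otimes>\<^bsub>G\<^esub> t \<in> t <#\<^bsub>G\<^esub> H}"
    using t lcos_self by simp
  moreover have "openin (subgroup_topology G \<Sigma>) {g \<in> carrier G. g \<otimes>\<^bsub>G\<^esub> t \<in> t <#\<^bsub>G\<^esub> H}"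
    using openin_continuous_map_preimage[OF cont openin_l_coset[OF G \<Sigma> t H]]
    by (simp add: topspace_subgroup_topology[OF G \<Sigma>])
  ultimately obtain K where
    K: "K \<in> \<Sigma>" "\<one>\<^bsub>G\<^esub> <#\<^bsub>G\<^esub> K \<subseteq> {g \<in> carrier G. g \<otimes>\<^bsub>G\<^esub> t \<in> t <#\<^bsub>G\<^esub> H}"
    using openin_subgroup_topology_iff[OF G \<Sigma>] by meson
  have "K \<subseteq> carrier G"
    using \<Sigma> K(1) by (simp add: neighbourhood_family_def subgroup.subset)
  then have "K \<subseteq> {g \<in> carrier G. g \<otimes>\<^bsub>G\<^esub> t \<in> t <#\<^bsub>G\<^esub> H}"
    using K(2) by (simp add: lcos_mult_one)
  then show thesis
    using that[OF K(1)] by auto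
qed

theorem proposition2p1:
  fixes G :: "('a, 'b) monoid_scheme" and \<Sigma> :: "'a set set"
  assumes "group G"
    and "neighbourhood_family G \<Sigma>"
    and "\<forall>t\<in>carrier G. continuous_map (subgroup_topology G \<Sigma>) (subgroup_topology G \<Sigma>)
           (\<lambda>g. g \<otimes>\<^bsub>G\<^esub> t)"
  shows "topological_group G (subgroup_topology G \<Sigma>)"
proof -
  interpret group G by fact
  let ?T = "subgroup_topology G \<Sigma>"
  note top = topspace_subgroup_topology[OF assms(1,2)]
  note open_iff = openin_subgroup_topology_iff[OF assms(1,2)]
  have sub: "subgroup H G" if "H \<in> \<Sigma>" for H
    using assms(2) that by (simp add: neighbourhood_family_def)
  have conj: "\<exists>K\<in>\<Sigma>. \<forall>k\<in>K. k \<otimes>\<^bsub>G\<^esub> t \<in> t <#\<^bsub>G\<^esub> H" if "t \<in> carrier G" "H \<in> \<Sigma>" for t H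
    using right_translation_conjugates[OF assms(1,2)] assms(3) that by metis
  have "continuous_map (prod_topology ?T ?T) ?T (\<lambda>(x, y). x \<otimes>\<^bsub>G\<^esub> y)"
    unfolding continuous_map
  proof (intro conjI allI impI)
    show "(\<lambda>(x, y). x \<otimes>\<^bsub>G\<^esub> y) ` topspace (prod_topology ?T ?T) \<subseteq> topspace ?T"
      by (auto simp: top)
    fix U assume U: "openin ?T U"
    show "openin (prod_topology ?T ?T)
        {p \<in> topspace (prod_topology ?T ?T). (case p of (x, y) \<Rightarrow> x \<otimes>\<^bsub>G\<^esub> y) \<in> U}" (is "openin _ ?P")
      unfolding openin_prod_topology_alt
    proof (intro allI impI)
      fix a b assume "(a, b) \<in> ?P"
      then have ab: "a \<in> carrier G" "b \<in> carrier G" "a \<otimes>\<^bsub>G\<^esub> b \<in> U"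
        by (auto simp: top)
      then obtain H where H: "H \<in> \<Sigma>" "(a \<otimes>\<^bsub>G\<^esub> b) <#\<^bsub>G\<^esub> H \<subseteq> U"
        using U open_iff by meson
      obtain K where K: "K \<in> \<Sigma>" "\<And>k. k \<in> K \<Longrightarrow> k \<otimes>\<^bsub>G\<^esub> b \<in> b <#\<^bsub>G\<^esub> H"
        using conj[OF ab(2) H(1)] by blast
      have "(a \<otimes>\<^bsub>G\<^esub> k) \<otimes>\<^bsub>G\<^esub> (b \<otimes>\<^bsub>G\<^esub> h) \<in> U \<and> a \<otimes>\<^bsub>G\<^esub> k \<in> carrier G \<and> b \<otimes>\<^bsub>G\<^esub> h \<in> carrier G"
        if kh: "k \<in> K" "h \<in> H" for k h
      proof -
        have c: "k \<in> carrier G" "h \<in> carrier G"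
          using kh sub[OF K(1)] sub[OF H(1)] by (auto dest: subgroup.mem_carrier)
        obtain h' where h': "h' \<in> H" "k \<otimes>\<^bsub>G\<^esub> b = b \<otimes>\<^bsub>G\<^esub> h'"
          using K(2)[OF kh(1)] by (auto simp: l_coset_def)
        have "h' \<in> carrier G"
          using h'(1) sub[OF H(1)] by (auto dest: subgroup.mem_carrier)
        \<comment> \<open>Moving \<open>k\<close> past \<open>b\<close> turns it into \<open>h' \<in> H\<close>, which merges with \<open>h\<close> in the subgroup.\<close>
        have "(a \<otimes>\<^bsub>G\<^esub> k) \<otimes>\<^bsub>G\<^esub> (b \<otimes>\<^bsub>G\<^esub> h) = a \<otimes>\<^bsub>G\<^esub> (k \<otimes>\<^bsub>G\<^esub> b) \<otimes>\<^bsub>G\<^esub> h"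
          using ab c by (simp add: m_assoc)
        also have "\<dots> = (a \<otimes>\<^bsub>G\<^esub> b) \<otimes>\<^bsub>G\<^esub> (h' \<otimes>\<^bsub>G\<^esub> h)"
          using ab c \<open>h' \<in> carrier G\<close> by (simp add: h'(2) m_assoc)
        also have "\<dots> \<in> (a \<otimes>\<^bsub>G\<^esub> b) <#\<^bsub>G\<^esub> H"
          using subgroup.m_closed[OF sub[OF H(1)] h'(1) kh(2)] by (auto simp: l_coset_def)
        finally show ?thesis
          using H(2) ab c by auto
      qed
      then have "(a <#\<^bsub>G\<^esub> K) \<times> (b <#\<^bsub>G\<^esub> H) \<subseteq> ?P"
        by (auto simp: l_coset_def top)
      then show "\<exists>V W. openin ?T V \<and> openin ?T W \<and> a \<in> V \<and> b \<in> W \<and> V \<times> W \<subseteq> ?P"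
        using openin_l_coset[OF assms(1,2) ab(1) K(1)] openin_l_coset[OF assms(1,2) ab(2) H(1)]
          lcos_self[OF ab(1) sub[OF K(1)]] lcos_self[OF ab(2) sub[OF H(1)]]
        by (intro exI conjI)
    qed
  qed
  moreover have "continuous_map ?T ?T (\<lambda>x. inv\<^bsub>G\<^esub> x)"
    unfolding continuous_map
  proof (intro conjI allI impI)
    show "(\<lambda>x. inv\<^bsub>G\<^esub> x) ` topspace ?T \<subseteq> topspace ?T"
      by (auto simp: top)
    fix U assume U: "openin ?T U"
    have "\<exists>K\<in>\<Sigma>. a <#\<^bsub>G\<^esub> K \<subseteq> {x \<in> carrier G. inv\<^bsub>G\<^esub> x \<in> U}"
      if a: "a \<in> carrier G" "inv\<^bsub>G\<^esub> a \<in> U" for a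
    proof -
      obtain H where H: "H \<in> \<Sigma>" "inv\<^bsub>G\<^esub> a <#\<^bsub>G\<^esub> H \<subseteq> U"
        using a U open_iff by meson
      obtain K where K: "K \<in> \<Sigma>" "\<And>k. k \<in> K \<Longrightarrow> k \<otimes>\<^bsub>G\<^esub> inv\<^bsub>G\<^esub> a \<in> inv\<^bsub>G\<^esub> a <#\<^bsub>G\<^esub> H"
        using conj[OF inv_closed[OF a(1)] H(1)] by blast
      have "a \<otimes>\<^bsub>G\<^esub> k \<in> carrier G \<and> inv\<^bsub>G\<^esub> (a \<otimes>\<^bsub>G\<^esub> k) \<in> U" if k: "k \<in> K" for k
      proof -
        have c: "k \<in> carrier G"
          using k sub[OF K(1)] by (auto dest: subgroup.mem_carrier)
        have "inv\<^bsub>G\<^esub> k \<in> K"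
          using k sub[OF K(1)] by (simp add: subgroup.m_inv_closed)
        then show ?thesis
          using K(2) H(2) a c by (auto simp: inv_mult_group)
      qed
      then show ?thesis
        using K(1) by (auto simp: l_coset_def)
    qed
    then show "openin ?T {x \<in> topspace ?T. inv\<^bsub>G\<^esub> x \<in> U}"
      by (auto simp: open_iff top)
  qed
  ultimately show ?thesis
    using assms(1) top by (simp add: topological_group_def)
qed

end
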